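(* Let $\mathcal{A},\mathcal{B}$ be finite alphabets and let $\sigma:\mathcal{A}\to\mathcal{B}^+$ be a (non-erasing) morphism such that at least one of the following holds: (a) $\mathrm{rk}(M_\sigma)=|\mathcal{A}|$, where $M_\sigma$ is the incidence matrix of $\sigma$; (b) $|\mathcal{A}|=2$; (c) $\sigma$ is left permutative or right permutative, or $\sigma$ is rotationally conjugate to a left or right permutative morphism. Then $\sigma$ is fully recognizable for aperiodic points, i.e., every aperiodic $y\in\mathcal{B}^{\mathbb{Z}}$ has at most one centered $\sigma$-representation in $\mathcal{A}^{\mathbb{Z}}$.
   Context: Alphabets are finite. $\mathcal{B}^*$ is the free monoid of finite words over $\mathcal{B}$, $\mathcal{B}^+$ the set of non-empty words. A morphism $\sigma:\mathcal{A}\to\mathcal{B}^+$ is given by a non-empty word $\sigma(a)$ for each letter $a$ and is extended by concatenation to $\mathcal{A}^*$ and to $\mathcal{A}^{\mathbb{Z}}$ (for $x\in\mathcal{A}^{\mathbb{Z}}$, $\sigma(x)=\cdots\sigma(x_{-1})\cdot\sigma(x_0)\sigma(x_1)\cdots$, with $\sigma(x_0)$ starting at index $0$). $|w|$ is the length of a word $w$. The incidence matrix $M_\sigma$ is the $|\mathcal{B}|\times|\mathcal{A}|$ matrix whose $(i,j)$ entry is the number of occurrences of $i$ in $\sigma(j)$. $T$ is the left shift, $(T x)_n=x_{n+1}$. A point $y$ is periodic if $T^k(y)=y$ for some $k\ge1$, and aperiodic otherwise. A $\sigma$-representation of $y\in\mathcal{B}^{\mathbb{Z}}$ is a pair $(k,x)$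 with $k\in\mathbb{Z}$, $x\in\mathcal{A}^{\mathbb{Z}}$ and $y=T^k\sigma(x)$; it is centered if $0\le k<|\sigma(x_0)|$. $\sigma$ is left (right) permutative if the first (last) letters of $\sigma(a)$ and $\sigma(b)$ are different for all distinct $a,b\in\mathcal{A}$. Two morphisms $\sigma,\tilde\sigma:\mathcal{A}\to\mathcal{B}^+$ are rotationally conjugate if there is a word $w\in\mathcal{B}^*$ such that $\sigma(a)w=w\tilde\sigma(a)$ for all $a\in\mathcal{A}$, or $w\sigma(a)=\tilde\sigma(a)w$ for all $a\in\mathcal{A}$. *)

theory Defs
  imports "HOL-Analysis.Analysis"
begin

type_synonym ('a, 'b) morphism = "'a \<Rightarrow> 'b list"

definition nonerasing :: "('a, 'b) morphism \<Rightarrow> bool" where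
  "nonerasing \<sigma> \<longleftrightarrow> (\<forall>a. \<sigma> a \<noteq> [])"

definition incidence_matrix :: "('a::finite, 'b::finite) morphism \<Rightarrow> real ^ 'a ^ 'b" where
  "incidence_matrix \<sigma> = (\<chi> i j. real (count_list (\<sigma> j) i))"

text \<open>The position at which the block \<open>\<sigma> (x n)\<close> starts in \<open>\<sigma>(x)\<close>; the block of \<open>x 0\<close> starts at \<open>0\<close>.
  For each \<open>n\<close> at most one of the two sums is non-empty.\<close>

definition block_start :: "('a, 'b) morphism \<Rightarrow> (int \<Rightarrow> 'a) \<Rightarrow> int \<Rightarrow> int" where
  "block_start \<sigma> x n =
     (\<Sum>i\<in>{0..<n}. int (length (\<sigma> (x i)))) - (\<Sum>i\<in>{n..<0}. int (length (\<sigma> (x i))))"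

text \<open>The extension of \<open>\<sigma>\<close> to bi-infinite sequences. It is meaningful only for non-erasing \<open>\<sigma>\<close>;
  see \<open>morph_ext_block\<close> and \<open>block_exists1\<close> below.\<close>

definition morph_ext :: "('a, 'b) morphism \<Rightarrow> (int \<Rightarrow> 'a) \<Rightarrow> (int \<Rightarrow> 'b)" where
  "morph_ext \<sigma> x m =
     (let n = (THE n. block_start \<sigma> x n \<le> m \<and> m < block_start \<sigma> x (n + 1))
      in \<sigma> (x n) ! nat (m - block_start \<sigma> x n))"

definition shift :: "(int \<Rightarrow> 'b) \<Rightarrow> (int \<Rightarrow> 'b)" where
  "shift x = (\<lambda>n. x (n + 1))"

text \<open>Integer powers of the (invertible) shift; see \<open>shift_pow_nat\<close> and \<open>shift_pow_minus\<close> below.\<close>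

definition shift_pow :: "int \<Rightarrow> (int \<Rightarrow> 'b) \<Rightarrow> (int \<Rightarrow> 'b)" where
  "shift_pow k x = (\<lambda>n. x (n + k))"

definition periodic :: "(int \<Rightarrow> 'b) \<Rightarrow> bool" where
  "periodic y \<longleftrightarrow> (\<exists>k::nat. k \<ge> 1 \<and> (shift ^^ k) y = y)"

abbreviation aperiodic :: "(int \<Rightarrow> 'b) \<Rightarrow> bool" where
  "aperiodic y \<equiv> \<not> periodic y"

definition representation :: "('a, 'b) morphism \<Rightarrow> (int \<Rightarrow> 'b) \<Rightarrow> int \<times> (int \<Rightarrow> 'a) \<Rightarrow> bool" where
  "representation \<sigma> y = (\<lambda>(k, x). y = shift_pow k (morph_ext \<sigma> x))"

definition centered_representation ::
    "('a, 'b) morphism \<Rightarrow> (int \<Rightarrow> 'b) \<Rightarrow> int \<times> (int \<Rightarrow> 'a) \<Rightarrow> bool" where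
  "centered_representation \<sigma> y =
     (\<lambda>(k, x). representation \<sigma> y (k, x) \<and> 0 \<le> k \<and> k < int (length (\<sigma> (x 0))))"

definition fully_recognizable_aperiodic :: "('a, 'b) morphism \<Rightarrow> bool" where
  "fully_recognizable_aperiodic \<sigma> \<longleftrightarrow>
     (\<forall>y. aperiodic y \<longrightarrow> (\<exists>\<^sub>\<le>\<^sub>1 p. centered_representation \<sigma> y p))"

definition left_permutative :: "('a, 'b) morphism \<Rightarrow> bool" where
  "left_permutative \<sigma> \<longleftrightarrow> (\<forall>a b. a \<noteq> b \<longrightarrow> hd (\<sigma> a) \<noteq> hd (\<sigma> b))"

definition right_permutative :: "('a, 'b) morphism \<Rightarrow> bool" where
  "right_permutative \<sigma> \<longleftrightarrow> (\<forall>a b. a \<noteq> b \<longrightarrow> last (\<sigma> a) \<noteq> last (\<sigma> b))"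

definition rotationally_conjugate :: "('a, 'b) morphism \<Rightarrow> ('a, 'b) morphism \<Rightarrow> bool" where
  "rotationally_conjugate \<sigma> \<tau> \<longleftrightarrow>
     (\<exists>w. (\<forall>a. \<sigma> a @ w = w @ \<tau> a) \<or> (\<forall>a. w @ \<sigma> a = \<tau> a @ w))"

lemma shift_pow_nat: "shift_pow (int k) = shift ^^ k"
proof (induction k)
  case 0
  show ?case by (simp add: shift_pow_def fun_eq_iff)
next
  case (Suc k)
  have "(shift ^^ Suc k) x = shift_pow (int (Suc k)) x" for x :: "int \<Rightarrow> 'a"
    by (simp add: Suc[symmetric] shift_pow_def shift_def add_ac)
  then show ?case by auto
qed

lemma shift_pow_minus: "shift_pow (- k) (shift_pow k x) = x"
  by (simp add: shift_pow_def)

lemma block_start_0: "block_start \<sigma> x 0 = 0"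
  by (simp add: block_start_def)

lemma block_start_Suc: "block_start \<sigma> x (n + 1) = block_start \<sigma> x n + int (length (\<sigma> (x n)))"
proof (cases "n \<ge> 0")
  case True
  then have "{0..<n + 1} = insert n {0..<n}" by auto
  with True show ?thesis by (simp add: block_start_def)
next
  case False
  then have "{n..<0} = insert n {n + 1..<0}" by auto
  with False show ?thesis by (simp add: block_start_def)
qed

lemma block_start_strict_mono:
  assumes "nonerasing \<sigma>" "m < n"
  shows "block_start \<sigma> x m < block_start \<sigma> x n"
  using assms(2)
proof (induction n rule: int_gr_induct)
  case base
  then show ?case using assms(1) by (simp add: block_start_Suc nonerasing_def)
next
  case (step i)
  then show ?case by (simp add: block_start_Suc)
qed

lemma block_unique:
  assumes "nonerasing \<sigma>"
    and "block_start \<sigma> x n \<le> m" "m < block_start \<sigma> x (n + 1)"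
    and "block_start \<sigma> x n' \<le> m" "m < block_start \<sigma> x (n' + 1)"
  shows "n' = n"
proof -
  have mono: "block_start \<sigma> x i \<le> block_start \<sigma> x j" if "i \<le> j" for i j
    using block_start_strict_mono[OF assms(1), of i j x] that by (cases "i = j") auto
  show ?thesis
    using mono[of "n + 1" n'] mono[of "n' + 1" n] assms(2-5) by (cases n n' rule: linorder_cases) auto
qed

lemma block_exists1:
  assumes "nonerasing \<sigma>"
  shows "\<exists>!n. block_start \<sigma> x n \<le> m \<and> m < block_start \<sigma> x (n + 1)"
proof -
  have len: "int (length (\<sigma> a)) \<ge> 1" for a
    using assms by (cases "\<sigma> a") (auto simp: nonerasing_def)
  have "\<exists>n. block_start \<sigma> x n \<le> m \<and> m < block_start \<sigma> x (n + 1)"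
  proof (induction m rule: int_induct[where k = 0])
    case base
    then show ?case
      using block_start_Suc[of \<sigma> x 0] len[of "x 0"] by (intro exI[of _ 0]) (auto simp: block_start_0)
  next
    case (step1 i)
    then obtain n where n: "block_start \<sigma> x n \<le> i" "i < block_start \<sigma> x (n + 1)" by auto
    show ?case
    proof (cases "i + 1 < block_start \<sigma> x (n + 1)")
      case True
      with n show ?thesis by (intro exI[of _ n]) auto
    next
      case False
      with n show ?thesis
        using block_start_Suc[of \<sigma> x "n + 1"] len[of "x (n + 1)"] by (intro exI[of _ "n + 1"]) auto
    qed
  next
    case (step2 i)
    then obtain n where n: "block_start \<sigma> x n \<le> i" "i < block_start \<sigma> x (n + 1)" by auto
    show ?case
    proof (cases "block_start \<sigma> x n \<le> i - 1")
      case True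
      with n show ?thesis by (intro exI[of _ n]) auto
    next
      case False
      with n show ?thesis
        using block_start_Suc[of \<sigma> x "n - 1"] len[of "x (n - 1)"] by (intro exI[of _ "n - 1"]) auto
    qed
  qed
  with block_unique[OF assms] show ?thesis by blast
qed

lemma morph_ext_block:
  assumes "nonerasing \<sigma>" "i < length (\<sigma> (x n))"
  shows "morph_ext \<sigma> x (block_start \<sigma> x n + int i) = \<sigma> (x n) ! i"
proof -
  let ?m = "block_start \<sigma> x n + int i"
  have "(THE n. block_start \<sigma> x n \<le> ?m \<and> ?m < block_start \<sigma> x (n + 1)) = n"
  proof (rule the1_equality[OF block_exists1[OF assms(1)]])
    show "block_start \<sigma> x n \<le> ?m \<and> ?m < block_start \<sigma> x (n + 1)"
      using assms(2) by (simp add: block_start_Suc)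
  qed
  then show ?thesis by (simp add: morph_ext_def)
qed

end

theory Submission
  imports Defs "HOL-Library.Omega_Words_Fun"
begin

text \<open>Call \<open>\<sigma>\<close> elementary if its images cannot be written as products of fewer than \<open>CARD('a)\<close> words.
  Full rank and permutativity imply this, and a non-elementary morphism on two letters has only
  periodic images. Rotational conjugacy merely shifts all parsings of a point.

  Let an elementary \<open>\<sigma>\<close> parse \<open>y\<close> in two ways. As long as the two parsings have no common cut, the
  pair of unread parts of the current blocks evolves deterministically from left to right: when a
  block ends inside a block of the other parsing, the unread part \<open>w\<close> of the latter determines the
  next letter, since otherwise the defect theorem for right-infinite words, applied to the images
  of \<open>\<sigma>\<close> together with \<open>w\<close>, would produce too few generators. There are finitely many such pairs, so
  without common cuts \<open>y\<close> is periodic, and a leftmost common cut would recur further to the left.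
  Hence common cuts occur arbitrarily far to the left, and from each of them on the parsings agree.\<close>

\<comment> \<open>Right-infinite products of blocks and the defect lemma\<close>
\<comment> \<open>The right-infinite products of blocks. There is no base case, so the inductive
  reading of the rule would give the empty set.\<close>
coinductive_set inf_words :: "('c \<Rightarrow> 'b list) \<Rightarrow> 'c set \<Rightarrow> (nat \<Rightarrow> 'b) set"
  for f :: "'c \<Rightarrow> 'b list" and S :: "'c set"
  where block: "c \<in> S \<Longrightarrow> y \<in> inf_words f S \<Longrightarrow> f c \<frown> y \<in> inf_words f S"

lemma conc_cancel: "w \<frown> x = w \<frown> y \<Longrightarrow> x = y"
proof
  fix n assume "w \<frown> x = w \<frown> y"
  then have "(w \<frown> x) (length w + n) = (w \<frown> y) (length w + n)" by simp
  then show "x n = y n" by (simp add: conc_def)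
qed

text \<open>Levi's lemma for a right-infinite word with two given prefixes.\<close>

lemma conc_eq_shorter:
  assumes "u \<frown> x = v \<frown> y" "length u \<le> length v"
  obtains t where "v = u @ t" "x = t \<frown> y"
proof -
  have nth: "(u \<frown> x) i = (v \<frown> y) i" for i using assms(1) by simp
  have "u = take (length u) v"
  proof (rule nth_equalityI)
    show "u ! i = take (length u) v ! i" if "i < length u" for i
      using nth[of i] that assms(2) by simp
  qed (use assms(2) in simp)
  then have v: "v = u @ drop (length u) v" by (metis append_take_drop_id)
  have "u \<frown> x = u \<frown> (drop (length u) v \<frown> y)" using assms(1) v by simp
  with v that conc_cancel show ?thesis by metis
qed

text \<open>Defect lemma by prefix elimination. If \<open>f a\<close>- and \<open>f b\<close>-words agree and \<open>f b = f a @ w\<close>, then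
  replacing \<open>f b\<close> by \<open>w\<close> shortens the code and sends words starting with \<open>f b\<close> to words starting
  with \<open>f a\<close>, which merges \<open>a\<close> and \<open>b\<close>. The new letter \<open>w\<close> costs no extra class: cancelling \<open>f a\<close> equates
  an infinite word starting with \<open>w\<close> with one that starts with another letter.\<close>

lemma prefix_hull:
  fixes f :: "'c \<Rightarrow> 'b list"
  assumes "finite S" "\<And>c. c \<in> S \<Longrightarrow> f c \<noteq> []"
  shows "\<exists>\<phi>. (\<forall>c\<in>S. \<phi> c \<noteq> []) \<and> (\<forall>c\<in>S. f c \<in> concat ` lists (\<phi> ` S)) \<and>
     (\<forall>a\<in>S. \<forall>b\<in>S. \<forall>u\<in>inf_words f S. \<forall>v\<in>inf_words f S. f a \<frown> u = f b \<frown> v \<longrightarrow> \<phi> a = \<phi> b)"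
  using assms
proof (induction "\<Sum>c\<in>S. length (f c)" arbitrary: f S rule: less_induct)
  case less
  show ?case
  proof (cases "\<forall>a\<in>S. \<forall>b\<in>S. \<forall>u\<in>inf_words f S. \<forall>v\<in>inf_words f S.
                  f a \<frown> u = f b \<frown> v \<longrightarrow> f a = f b")
    case True
    have "f c \<in> concat ` lists (f ` S)" if "c \<in> S" for c
      using that by (intro image_eqI[of _ _ "[f c]"]) auto
    with True less.prems show ?thesis by (intro exI[of _ f]) simp
  next
    case False
    then obtain a b u v where ab: "a \<in> S" "b \<in> S" "f a \<noteq> f b" "length (f a) \<le> length (f b)"
      and uv: "u \<in> inf_words f S" "v \<in> inf_words f S" "f a \<frown> u = f b \<frown> v"
      by (metis nle_le)
    from uv(3) ab(4) obtain w where w: "f b = f a @ w" "u = w \<frown> v" by (rule conc_eq_shorter)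
    have "a \<noteq> b" "w \<noteq> []" using ab w by auto
    define f' where "f' = f(b := w)"
    have f'_simps: "f' b = w" "\<And>c. c \<noteq> b \<Longrightarrow> f' c = f c" "f b = f' a @ f' b"
      using w \<open>a \<noteq> b\<close> by (auto simp: f'_def)
    have "(\<Sum>c\<in>S. length (f' c)) < (\<Sum>c\<in>S. length (f c))"
      using ab less.prems(1) less.prems(2)[OF ab(1)] w \<open>a \<noteq> b\<close>
      by (intro sum_strict_mono_ex1) (auto simp: f'_def)
    moreover have "f' c \<noteq> []" if "c \<in> S" for c
      using that less.prems(2) \<open>w \<noteq> []\<close> by (simp add: f'_def)
    ultimately obtain \<psi> where "(\<forall>c\<in>S. \<psi> c \<noteq> []) \<and> (\<forall>c\<in>S. f' c \<in> concat ` lists (\<psi> ` S)) \<and>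
       (\<forall>a\<in>S. \<forall>b\<in>S. \<forall>u\<in>inf_words f' S. \<forall>v\<in>inf_words f' S. f' a \<frown> u = f' b \<frown> v \<longrightarrow> \<psi> a = \<psi> b)"
      using less.hyps[OF _ less.prems(1), of f'] by blast
    then have \<psi>: "\<And>c. c \<in> S \<Longrightarrow> \<psi> c \<noteq> []" "\<And>c. c \<in> S \<Longrightarrow> f' c \<in> concat ` lists (\<psi> ` S)"
      "\<And>a b u v. a \<in> S \<Longrightarrow> b \<in> S \<Longrightarrow> u \<in> inf_words f' S \<Longrightarrow> v \<in> inf_words f' S \<Longrightarrow>
         f' a \<frown> u = f' b \<frown> v \<Longrightarrow> \<psi> a = \<psi> b"
      by blast+
    have sub: "y \<in> inf_words f' S" if "y \<in> inf_words f S" for y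
    proof -
      \<comment> \<open>A block \<open>f b\<close> is now emitted in two steps, first
        \<open>f' a\<close> and then \<open>w\<close>; the second disjunct is the state between
        them.\<close>
      have "y \<in> inf_words f S \<or> (\<exists>z\<in>inf_words f S. y = w \<frown> z)" using that by (rule disjI1)
      then show ?thesis
      proof (coinduction arbitrary: y)
        case inf_words
        then show ?case
        proof
          assume "y \<in> inf_words f S"
          then obtain c z where c: "y = f c \<frown> z" "c \<in> S" "z \<in> inf_words f S"
            by (auto elim: inf_words.cases)
          show ?thesis
          proof (cases "c = b")
            case True
            then have "y = f' a \<frown> (w \<frown> z)" using c f'_simps by simp
            then show ?thesis using c ab(1) by blast
          next
            case False
            then show ?thesis using c f'_simps(2)[of c] by (intro exI[of _ c] exI[of _ z]) simp
          qed
        next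
          assume "\<exists>z\<in>inf_words f S. y = w \<frown> z"
          then show ?thesis using f'_simps(1) ab(2) by auto
        qed
      qed
    qed
    \<comment> \<open>A word that starts with the old block \<open>f b\<close> starts with the new
      block \<open>f' a\<close>, so \<open>b\<close> is represented by \<open>a\<close>.\<close>
    define red where "red c = (if c = b then a else c)" for c
    have red: "\<exists>z\<in>inf_words f' S. f c \<frown> y = f' (red c) \<frown> z" if "y \<in> inf_words f S" "c \<in> S" for c y
    proof (cases "c = b")
      case True
      have "f' b \<frown> y \<in> inf_words f' S" using sub[OF that(1)] ab(2) by (rule inf_words.block[rotated])
      then show ?thesis using True f'_simps(3) by (intro bexI[of _ "f' b \<frown> y"]) (auto simp: red_def)
    next
      case False
      then show ?thesis using sub[OF that(1)] f'_simps(2) by (auto simp: red_def)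
    qed
    have red_S: "red c \<in> S" "red c \<noteq> b" if "c \<in> S" for c using that ab \<open>a \<noteq> b\<close> by (auto simp: red_def)
    \<comment> \<open>\<open>red\<close> never takes the value \<open>b\<close>, so
      \<open>\<psi> b\<close> must be found at another letter for \<open>\<psi> \<circ> red\<close>
      to keep the image of \<open>\<psi>\<close>.\<close>
    obtain c where c: "c \<in> S" "\<psi> b = \<psi> (red c)"
    proof -
      from uv(1) obtain c y where cy: "c \<in> S" "y \<in> inf_words f S" "u = f c \<frown> y"
        by (auto elim: inf_words.cases)
      with red obtain z where z: "z \<in> inf_words f' S" "u = f' (red c) \<frown> z" by blast
      have "f' b \<frown> v = f' (red c) \<frown> z" using z w f'_simps by simp
      then show ?thesis using \<psi>(3) that cy(1) red_S z(1) sub[OF uv(2)] ab(2) by blast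
    qed
    have img: "(\<psi> \<circ> red) ` S = \<psi> ` S"
    proof
      show "\<psi> ` S \<subseteq> (\<psi> \<circ> red) ` S"
      proof
        fix p assume "p \<in> \<psi> ` S"
        then obtain d where "d \<in> S" "p = \<psi> d" by blast
        then show "p \<in> (\<psi> \<circ> red) ` S" using c by (cases "d = b") (auto simp: red_def)
      qed
    qed (use red_S in auto)
    have generated: "f d \<in> concat ` lists (\<psi> ` S)" if "d \<in> S" for d
    proof (cases "d = b")
      case True
      obtain p q where "p \<in> lists (\<psi> ` S)" "q \<in> lists (\<psi> ` S)" "f' a = concat p" "f' b = concat q"
        using \<psi>(2) ab by blast
      then show ?thesis using True f'_simps(3) by (intro image_eqI[of _ _ "p @ q"]) auto
    qed (use \<psi>(2)[OF that] f'_simps in simp)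
    have phi_eq: "\<psi> (red d) = \<psi> (red e)"
      if de: "d \<in> S" "e \<in> S" "p \<in> inf_words f S" "q \<in> inf_words f S" "f d \<frown> p = f e \<frown> q" for d e p q
    proof -
      obtain p' q' where "p' \<in> inf_words f' S" "f d \<frown> p = f' (red d) \<frown> p'"
        "q' \<in> inf_words f' S" "f e \<frown> q = f' (red e) \<frown> q'"
        using red[OF de(3,1)] red[OF de(4,2)] by blast
      then show ?thesis using \<psi>(3)[of "red d" "red e" p' q'] red_S de by simp
    qed
    show ?thesis
    proof (intro exI[of _ "\<psi> \<circ> red"] conjI ballI impI)
      show "(\<psi> \<circ> red) d \<noteq> []" if "d \<in> S" for d using \<psi>(1) red_S that by simp
      show "f d \<in> concat ` lists ((\<psi> \<circ> red) ` S)" if "d \<in> S" for d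
        unfolding img using that by (rule generated)
      show "(\<psi> \<circ> red) d = (\<psi> \<circ> red) e"
        if "d \<in> S" "e \<in> S" "p \<in> inf_words f S" "q \<in> inf_words f S" "f d \<frown> p = f e \<frown> q" for d e p q
        unfolding o_apply using that by (rule phi_eq)
    qed
  qed
qed

section \<open>Elementary morphisms\<close>

definition elementary :: "('a::finite, 'b) morphism \<Rightarrow> bool" where
  "elementary \<sigma> \<longleftrightarrow>
     (\<forall>P. finite P \<longrightarrow> [] \<notin> P \<longrightarrow> range \<sigma> \<subseteq> concat ` lists P \<longrightarrow> CARD('a) \<le> card P)"

text \<open>Adjoin \<open>w\<close> to the code as an additional letter: two distinct successors of \<open>w\<close> would merge three
  of the \<open>CARD('a) + 1\<close> letters, leaving fewer than \<open>CARD('a)\<close> words.\<close>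

lemma elementary_deterministic:
  fixes \<sigma> :: "('a::finite, 'b) morphism"
  assumes "nonerasing \<sigma>" "elementary \<sigma>" "w \<noteq> []"
    and "u\<^sub>1 \<in> inf_words \<sigma> UNIV" "v\<^sub>1 \<in> inf_words \<sigma> UNIV" "w \<frown> u\<^sub>1 = \<sigma> a\<^sub>1 \<frown> v\<^sub>1"
    and "u\<^sub>2 \<in> inf_words \<sigma> UNIV" "v\<^sub>2 \<in> inf_words \<sigma> UNIV" "w \<frown> u\<^sub>2 = \<sigma> a\<^sub>2 \<frown> v\<^sub>2"
  shows "a\<^sub>1 = a\<^sub>2"
proof (rule ccontr)
  assume "a\<^sub>1 \<noteq> a\<^sub>2"
  define f where "f = case_option w \<sigma>"
  have sub: "y \<in> inf_words f UNIV" if "y \<in> inf_words \<sigma> UNIV" for y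
    using that
  proof (coinduction arbitrary: y)
    case inf_words
    then obtain a z where "y = \<sigma> a \<frown> z" "z \<in> inf_words \<sigma> UNIV" by (auto elim: inf_words.cases)
    then show ?case by (intro exI[of _ "Some a"] exI[of _ z]) (simp add: f_def)
  qed
  have "f c \<noteq> []" for c using assms(1,3) by (auto simp: f_def nonerasing_def split: option.split)
  then obtain \<phi> where "(\<forall>c. \<phi> c \<noteq> []) \<and> (\<forall>c. f c \<in> concat ` lists (range \<phi>)) \<and>
     (\<forall>a b. \<forall>u\<in>inf_words f UNIV. \<forall>v\<in>inf_words f UNIV. f a \<frown> u = f b \<frown> v \<longrightarrow> \<phi> a = \<phi> b)"
    using prefix_hull[of UNIV f] by auto
  then have \<phi>: "\<And>c. \<phi> c \<noteq> []" "\<And>c. f c \<in> concat ` lists (range \<phi>)"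
    "\<And>a b u v. u \<in> inf_words f UNIV \<Longrightarrow> v \<in> inf_words f UNIV \<Longrightarrow> f a \<frown> u = f b \<frown> v \<Longrightarrow> \<phi> a = \<phi> b"
    by blast+
  have "\<phi> None = \<phi> (Some a\<^sub>1)" by (rule \<phi>(3)[of u\<^sub>1 v\<^sub>1]) (use assms sub in \<open>auto simp: f_def\<close>)
  moreover have "\<phi> None = \<phi> (Some a\<^sub>2)" by (rule \<phi>(3)[of u\<^sub>2 v\<^sub>2]) (use assms sub in \<open>auto simp: f_def\<close>)
  ultimately have eq: "\<phi> None = \<phi> (Some a\<^sub>1)" "\<phi> (Some a\<^sub>2) = \<phi> (Some a\<^sub>1)" by simp_all
  have "\<phi> c \<in> (\<phi> \<circ> Some) ` (UNIV - {a\<^sub>2})" for c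
  proof (cases "c = None \<or> c = Some a\<^sub>2")
    case True
    then have "\<phi> c = (\<phi> \<circ> Some) a\<^sub>1" using eq by auto
    then show ?thesis using \<open>a\<^sub>1 \<noteq> a\<^sub>2\<close> by blast
  qed auto
  then have "range \<phi> = (\<phi> \<circ> Some) ` (UNIV - {a\<^sub>2})" by auto
  then have "card (range \<phi>) \<le> card (UNIV - {a\<^sub>2})" by (metis card_image_le finite)
  also have "\<dots> < CARD('a)" by (rule psubset_card_mono) auto
  finally have "\<not> CARD('a) \<le> card (range \<phi>)" by simp
  moreover have "range \<sigma> \<subseteq> concat ` lists (range \<phi>)"
    using \<phi>(2)[of "Some _"] by (auto simp: f_def)
  ultimately show False using assms(2) \<phi>(1) unfolding elementary_def by (metis finite finite_imageI rangeE)
qed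

text \<open>Determinism with \<open>w = \<sigma> a\<close>: the factorization starting with
  \<open>\<sigma> b\<close> is compared with the trivial one starting with \<open>\<sigma> a\<close>
  itself.\<close>

lemma elementary_left_cancel:
  fixes \<sigma> :: "('a::finite, 'b) morphism"
  assumes "nonerasing \<sigma>" "elementary \<sigma>"
    and "u \<in> inf_words \<sigma> UNIV" "v \<in> inf_words \<sigma> UNIV" "\<sigma> a \<frown> u = \<sigma> b \<frown> v"
  shows "a = b"
  using elementary_deterministic[of \<sigma> "\<sigma> a" u u a u v b] assms by (simp add: nonerasing_def)

section \<open>Parsings of a bi-infinite word\<close>

definition ray :: "(int \<Rightarrow> 'b) \<Rightarrow> int \<Rightarrow> nat \<Rightarrow> 'b" where
  "ray y p = (\<lambda>i. y (p + int i))"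

text \<open>A representation seen from \<open>y\<close>: \<open>c n\<close> is the position in
  \<open>y\<close> where the block of \<open>x n\<close> starts. With the cuts as data, the same
  \<open>x\<close> and \<open>c\<close> can serve for a conjugate morphism and a shifted
  point.\<close>

locale parsing =
  fixes \<sigma> :: "('a, 'b) morphism" and y :: "int \<Rightarrow> 'b" and x :: "int \<Rightarrow> 'a" and c :: "int \<Rightarrow> int"
  assumes nonerasing: "nonerasing \<sigma>"
    and cut_step: "c (n + 1) = c n + int (length (\<sigma> (x n)))"
    and cut_block: "i < length (\<sigma> (x n)) \<Longrightarrow> y (c n + int i) = \<sigma> (x n) ! i"
begin

lemma cut_eq_block_start: "c n = c 0 + block_start \<sigma> x n"
proof (induction n rule: int_induct[where k = 0])
  case base
  show ?case by (simp add: block_start_0)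
next
  case (step1 i)
  then show ?case by (simp add: cut_step block_start_Suc)
next
  case (step2 i)
  then show ?case using cut_step[of "i - 1"] block_start_Suc[of \<sigma> x "i - 1"] by simp
qed

lemma cut_strict_mono: "strict_mono c"
proof (rule strict_monoI)
  fix m n :: int
  assume "m < n"
  then have "block_start \<sigma> x m < block_start \<sigma> x n" by (rule block_start_strict_mono[OF nonerasing])
  then show "c m < c n" using cut_eq_block_start[of m] cut_eq_block_start[of n] by linarith
qed

lemma block_ex: "\<exists>n. c n \<le> p \<and> p < c (n + 1)"
proof -
  obtain n where "block_start \<sigma> x n \<le> p - c 0 \<and> p - c 0 < block_start \<sigma> x (n + 1)"
    using block_exists1[OF nonerasing, of x "p - c 0"] by blast
  then show ?thesis
    using cut_eq_block_start[of n] cut_eq_block_start[of "n + 1"] by (intro exI[of _ n]) linarith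
qed

text \<open>The unread part of the block that covers position \<open>p\<close>, with the letter at
  \<open>p\<close> still included; hence it has length 1 just before a cut.\<close>

definition rest :: "int \<Rightarrow> 'b list" where
  "rest p = (let n = THE n. c n \<le> p \<and> p < c (n + 1) in drop (nat (p - c n)) (\<sigma> (x n)))"

lemma rest_eq:
  assumes "c n \<le> p" "p < c (n + 1)"
  shows "rest p = drop (nat (p - c n)) (\<sigma> (x n))"
proof -
  have "(THE n. c n \<le> p \<and> p < c (n + 1)) = n"
  proof (rule the_equality)
    show "m = n" if "c m \<le> p \<and> p < c (m + 1)" for m
    proof -
      have "c m < c (n + 1)" "c n < c (m + 1)" using that assms by simp_all
      then show ?thesis using strict_mono_less[OF cut_strict_mono] by (metis zle_add1_eq_le order_antisym)
    qed
  qed (use assms in simp)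
  then show ?thesis by (simp add: rest_def)
qed

lemma rest_cut: "rest (c n) = \<sigma> (x n)"
  using rest_eq[of n "c n"] nonerasing by (simp add: cut_step nonerasing_def)

text \<open>These facts make \<open>rest\<close> the state of a left-to-right scan: it has finitely
  many values, shows the current letter of \<open>y\<close>, and loses its first letter at each step
  until the block ends. All follow by writing \<open>p\<close> as an offset \<open>k\<close> in a
  block \<open>n\<close>.\<close>

lemma rest_nonempty: "rest p \<noteq> []"
  and hd_rest: "hd (rest p) = y p"
  and rest_suffix: "rest p \<in> (\<Union>a. (\<lambda>i. drop i (\<sigma> a)) ` {..length (\<sigma> a)})"
  and rest_Suc: "length (rest p) \<noteq> 1 \<Longrightarrow> rest (p + 1) = tl (rest p)"
  and length_rest_1_iff: "length (rest p) = 1 \<longleftrightarrow> p + 1 \<in> range c"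
proof -
  obtain n where n: "c n \<le> p" "p < c (n + 1)" using block_ex by blast
  define k where "k = nat (p - c n)"
  have k: "k < length (\<sigma> (x n))" "p = c n + int k" using n cut_step[of n] by (auto simp: k_def)
  have rest: "rest p = drop k (\<sigma> (x n))" using rest_eq[OF n] by (simp add: k_def)
  show "rest p \<noteq> []" using k rest by simp
  show "hd (rest p) = y p" using k rest cut_block[of k n] by (simp add: hd_drop_conv_nth)
  show "rest p \<in> (\<Union>a. (\<lambda>i. drop i (\<sigma> a)) ` {..length (\<sigma> a)})"
    using rest k(1) by (intro UN_I[of "x n"] image_eqI[of _ _ k]) simp_all
  show "rest (p + 1) = tl (rest p)" if "length (rest p) \<noteq> 1"
  proof -
    have "p + 1 < c (n + 1)" using that rest k cut_step[of n] by auto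
    then have "rest (p + 1) = drop (Suc k) (\<sigma> (x n))"
      using rest_eq[of n "p + 1"] n k by (simp add: nat_add_distrib)
    then show ?thesis using rest by (simp add: drop_Suc tl_drop)
  qed
  show "length (rest p) = 1 \<longleftrightarrow> p + 1 \<in> range c"
  proof
    assume "length (rest p) = 1"
    then have "p + 1 = c (n + 1)" using rest k cut_step[of n] by auto
    then show "p + 1 \<in> range c" by simp
  next
    assume "p + 1 \<in> range c"
    then obtain m where m: "p + 1 = c m" by blast
    then have "c n < c m" "c m \<le> c (n + 1)" using n by simp_all
    then have "m = n + 1"
      using strict_mono_less[OF cut_strict_mono] strict_mono_less_eq[OF cut_strict_mono]
      by (metis zle_add1_eq_le add1_zle_eq order_antisym)
    then show "length (rest p) = 1" using m rest k cut_step[of n] by simp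
  qed
qed

lemma ray_cut: "ray y (c n) = \<sigma> (x n) \<frown> ray y (c (n + 1))"
proof
  fix i
  show "ray y (c n) i = (\<sigma> (x n) \<frown> ray y (c (n + 1))) i"
    using cut_block[of i n] by (cases "i < length (\<sigma> (x n))") (auto simp: ray_def cut_step of_nat_diff)
qed

lemma ray_cut_in_inf_words: "ray y (c n) \<in> inf_words \<sigma> UNIV"
  by (coinduction arbitrary: n) (use ray_cut in blast)

lemma ray_rest:
  obtains u where "u \<in> inf_words \<sigma> UNIV" "ray y p = rest p \<frown> u"
proof -
  obtain n where n: "c n \<le> p" "p < c (n + 1)" using block_ex by blast
  define k where "k = nat (p - c n)"
  have k: "k < length (\<sigma> (x n))" "p = c n + int k" using n cut_step[of n] by (auto simp: k_def)
  have "ray y p = suffix k (ray y (c n))" using k by (auto simp: ray_def suffix_def algebra_simps)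
  also have "\<dots> = drop k (\<sigma> (x n)) \<frown> ray y (c (n + 1))"
    using k by (subst ray_cut) (simp add: suffix_conc_fst)
  finally have "ray y p = rest p \<frown> ray y (c (n + 1))" using rest_eq[OF n] by (simp add: k_def)
  then show ?thesis using that ray_cut_in_inf_words by blast
qed

end

section \<open>Comparing two parsings of one point\<close>

text \<open>The rays at both cuts begin with the same unread word of the other parsing, followed by
  a product of blocks, so \<open>elementary_deterministic\<close> applies with this word as
  \<open>w\<close>.\<close>

lemma parsing_next_letter:
  fixes \<sigma> :: "('a::finite, 'b) morphism"
  assumes "elementary \<sigma>" "parsing \<sigma> y x c" "parsing \<sigma> y x' c'"
    and "parsing.rest \<sigma> x' c' (c m) = parsing.rest \<sigma> x' c' (c n)"
  shows "x m = x n"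
proof -
  interpret P: parsing \<sigma> y x c by fact
  interpret Q: parsing \<sigma> y x' c' by fact
  obtain u where "u \<in> inf_words \<sigma> UNIV" "ray y (c m) = Q.rest (c m) \<frown> u" by (rule Q.ray_rest)
  moreover obtain v where "v \<in> inf_words \<sigma> UNIV" "ray y (c n) = Q.rest (c n) \<frown> v" by (rule Q.ray_rest)
  ultimately show ?thesis
    using elementary_deterministic[OF P.nonerasing assms(1) Q.rest_nonempty[of "c m"]]
      P.ray_cut P.ray_cut_in_inf_words assms(4) by metis
qed

text \<open>At a common cut both parsings factor the same ray, so left cancellation yields equal
  letters and the next cut is again common. The argument only runs to the right.\<close>

lemma common_cut_forward:
  fixes \<sigma> :: "('a::finite, 'b) morphism"
  assumes "elementary \<sigma>" "parsing \<sigma> y x c" "parsing \<sigma> y x' c'"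
    and "c n = c' n'" "n \<le> m"
  shows "x' (m + (n' - n)) = x m \<and> c' (m + (n' - n)) = c m"
proof -
  interpret P: parsing \<sigma> y x c by fact
  interpret Q: parsing \<sigma> y x' c' by fact
  have letter: "x' j = x i" if "c' j = c i" for i j
    using elementary_left_cancel[OF P.nonerasing assms(1)]
      P.ray_cut[of i] Q.ray_cut[of j] P.ray_cut_in_inf_words Q.ray_cut_in_inf_words that by metis
  have "c' (m + (n' - n)) = c m"
    using assms(5)
  proof (induction m rule: int_ge_induct)
    case base
    then show ?case using assms(4) by simp
  next
    case (step i)
    then show ?case using P.cut_step[of i] Q.cut_step[of "i + (n' - n)"] letter by (simp add: algebra_simps)
  qed
  then show ?thesis using letter by simp
qed

section \<open>Deterministic sequences with finitely many states\<close>

lemma infinite_int_unbounded_below: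
  assumes "infinite I" "I \<subseteq> {..m::int}"
  shows "\<exists>a\<in>I. a < N"
proof (rule ccontr)
  assume "\<not> ?thesis"
  then have "I \<subseteq> {N..m}" using assms(2) by force
  then show False using assms(1) finite_subset by blast
qed

lemma infinitely_recurrent_left:
  fixes s :: "int \<Rightarrow> 's"
  assumes "finite (range s)"
  obtains I where "infinite I" "I \<subseteq> {..m}" "\<And>p q. p \<in> I \<Longrightarrow> q \<in> I \<Longrightarrow> s p = s q"
proof -
  have "infinite {..m}" "finite (s ` {..m})"
    using assms infinite_Iic by (simp_all add: finite_subset[OF image_mono[OF subset_UNIV]])
  then obtain a where "infinite {p \<in> {..m}. s p = s a}" using pigeonhole_infinite by metis
  then show ?thesis using that by (metis (mono_tags, lifting) mem_Collect_eq subsetI)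
qed

lemma iterate_step:
  fixes s :: "int \<Rightarrow> 's"
  assumes "\<And>p q. p < m \<Longrightarrow> q < m \<Longrightarrow> s p = s q \<Longrightarrow> s (p + 1) = s (q + 1)"
    and "s p = s q" "p + int i \<le> m" "q + int i \<le> m"
  shows "s (p + int i) = s (q + int i)"
  using assms(3,4)
proof (induction i)
  case (Suc i)
  then show ?case using assms(1)[of "p + int i" "q + int i"] by (simp add: algebra_simps)
qed (use assms(2) in simp)

text \<open>Some state repeats at two positions up to \<open>m\<close>; determinism carries this
  repetition forward until the later position reaches \<open>m\<close>.\<close>

lemma deterministic_recurs:
  fixes s :: "int \<Rightarrow> 's"
  assumes "finite (range s)"
    and "\<And>p q. p < m \<Longrightarrow> q < m \<Longrightarrow> s p = s q \<Longrightarrow> s (p + 1) = s (q + 1)"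
  shows "\<exists>p<m. s p = s m"
proof -
  obtain I where I: "infinite I" "I \<subseteq> {..m}" "\<And>p q. p \<in> I \<Longrightarrow> q \<in> I \<Longrightarrow> s p = s q"
    using infinitely_recurrent_left[OF assms(1)] by blast
  obtain q where q: "q \<in> I" using infinite_int_unbounded_below[OF I(1,2)] by blast
  obtain p where p: "p \<in> I" "p < q" using infinite_int_unbounded_below[OF I(1,2)] by blast
  have "q \<le> m" using q I(2) by auto
  have "s (p + int (nat (m - q))) = s (q + int (nat (m - q)))"
    using p(2) \<open>q \<le> m\<close> by (intro iterate_step[OF assms(2) I(3)[OF p(1) q], of m]) simp_all
  then show ?thesis using p(2) \<open>q \<le> m\<close> by (intro exI[of _ "p + (m - q)"]) simp
qed

text \<open>A repetition only determines what lies to its right, but one state recurs arbitrarily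
  far to the left, so the period holds everywhere.\<close>

lemma deterministic_periodic:
  fixes s :: "int \<Rightarrow> 's"
  assumes "finite (range s)" and step: "\<And>p q. s p = s q \<Longrightarrow> s (p + 1) = s (q + 1)"
  obtains d where "d > 0" "\<And>p. s (p + d) = s p"
proof -
  obtain I where I: "infinite I" "I \<subseteq> {..0}" "\<And>p q. p \<in> I \<Longrightarrow> q \<in> I \<Longrightarrow> s p = s q"
    using infinitely_recurrent_left[OF assms(1)] by blast
  obtain b where b: "b \<in> I" using infinite_int_unbounded_below[OF I(1,2)] by blast
  obtain a where a: "a \<in> I" "a < b" using infinite_int_unbounded_below[OF I(1,2)] by blast
  have iter: "s (p + i) = s (q + i)" if "p \<in> I" "q \<in> I" "i \<ge> 0" for p q i
    using iterate_step[OF step I(3)[OF that(1,2)], of "max (p + i) (q + i)" "nat i"] that(3) by simp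
  have "s (p + (b - a)) = s p" for p
  proof -
    obtain e where e: "e \<in> I" "e < p" using infinite_int_unbounded_below[OF I(1,2)] by blast
    \<comment> \<open>The positions \<open>e\<close>, \<open>a\<close> and \<open>b\<close> share
      one state. Starting at \<open>a\<close> instead of \<open>e\<close> leads to position
      \<open>b + (p - e)\<close>, and starting there from \<open>e\<close> instead of
      \<open>b\<close> leads back to \<open>p\<close>.\<close>
    have "s (e + (p - e + (b - a))) = s (a + (p - e + (b - a)))" using e a b by (intro iter) auto
    moreover have "s (b + (p - e)) = s (e + (p - e))" using e b by (intro iter) auto
    moreover have "a + (p - e + (b - a)) = b + (p - e)" by simp
    ultimately show ?thesis by simp
  qed
  then show ?thesis using that[of "b - a"] a by simp
qed

lemma periodic_iff: "periodic y \<longleftrightarrow> (\<exists>d>0. \<forall>p. y (p + d) = y p)"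
proof
  assume "periodic y"
  then obtain k where "k \<ge> 1" "shift_pow (int k) y = y" by (auto simp: periodic_def shift_pow_nat)
  then show "\<exists>d>0. \<forall>p. y (p + d) = y p" by (intro exI[of _ "int k"]) (auto simp: shift_pow_def fun_eq_iff)
next
  assume "\<exists>d>0. \<forall>p. y (p + d) = y p"
  then obtain d where "d > 0" "\<forall>p. y (p + d) = y p" by blast
  then show "periodic y" unfolding periodic_def shift_pow_nat[symmetric]
    by (intro exI[of _ "nat d"]) (auto simp: shift_pow_def)
qed

section \<open>Uniqueness of parsings for elementary morphisms\<close>

lemma elementary_parsing_unique:
  fixes \<sigma> :: "('a::finite, 'b) morphism"
  assumes "elementary \<sigma>" "aperiodic y" "parsing \<sigma> y x c" "parsing \<sigma> y x' c'"
  shows "\<exists>d. \<forall>n. x' (n + d) = x n \<and> c' (n + d) = c n"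
proof -
  interpret P: parsing \<sigma> y x c by fact
  interpret Q: parsing \<sigma> y x' c' by fact
  define C where "C = range c \<inter> range c'"
  define s where "s p = (P.rest p, Q.rest p)" for p
  define F where "F = (\<Union>a. (\<lambda>i. drop i (\<sigma> a)) ` {..length (\<sigma> a)})"
  have "range s \<subseteq> F \<times> F" using P.rest_suffix Q.rest_suffix by (auto simp: s_def F_def)
  moreover have "finite F" by (simp add: F_def)
  ultimately have fin: "finite (range s)" by (meson finite_SigmaI finite_subset)
  \<comment> \<open>Only at a common cut do both parsings choose a new letter at once. Otherwise at
    most one block ends, and the unread part of the other block determines the new letter.\<close>
  have s_step: "s (p + 1) = s (q + 1)" if eq: "s p = s q" and notC: "p + 1 \<notin> C" for p q
  proof -
    have eqs: "P.rest p = P.rest q" "Q.rest p = Q.rest q" using eq by (auto simp: s_def)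
    consider "length (P.rest p) \<noteq> 1" "length (Q.rest p) \<noteq> 1"
      | "length (P.rest p) = 1" "length (Q.rest p) \<noteq> 1"
      | "length (P.rest p) \<noteq> 1" "length (Q.rest p) = 1"
      using notC P.length_rest_1_iff Q.length_rest_1_iff by (auto simp: C_def)
    then show ?thesis
    proof cases
      case 1
      then show ?thesis using eqs P.rest_Suc Q.rest_Suc by (simp add: s_def)
    next
      case 2
      then obtain m n where mn: "p + 1 = c m" "q + 1 = c n"
        using eqs P.length_rest_1_iff by (metis imageE)
      have "Q.rest (p + 1) = Q.rest (q + 1)" using 2 eqs Q.rest_Suc by simp
      then show ?thesis using parsing_next_letter[OF assms(1,3,4), of m n] mn P.rest_cut by (simp add: s_def)
    next
      case 3
      then obtain m n where mn: "p + 1 = c' m" "q + 1 = c' n"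
        using eqs Q.length_rest_1_iff by (metis imageE)
      have "P.rest (p + 1) = P.rest (q + 1)" using 3 eqs P.rest_Suc by simp
      then show ?thesis using parsing_next_letter[OF assms(1,4,3), of m n] mn Q.rest_cut by (simp add: s_def)
    qed
  qed
  have "C \<noteq> {}"
  proof
    assume "C = {}"
    then obtain d where "d > 0" "\<And>p. s (p + d) = s p"
      using deterministic_periodic[OF fin] s_step by (metis empty_iff)
    then have "periodic y"
      unfolding periodic_iff s_def using P.hd_rest by (metis prod.inject)
    then show False using assms(2) by simp
  qed
  moreover have unbounded: "\<exists>p\<in>C. p < N" for N
  proof (rule ccontr)
    assume "\<not> ?thesis"
    then have lower: "N \<le> p" if "p \<in> C" for p using that by force
    \<comment> \<open>Measuring from the lower bound \<open>N\<close> turns the leftmost common cut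
      into a least natural number.\<close>
    define k where "k = (LEAST k. N + int k \<in> C)"
    obtain p where "p \<in> C" using \<open>C \<noteq> {}\<close> by blast
    then have "N + int (nat (p - N)) \<in> C" using lower by simp
    then have "N + int k \<in> C" unfolding k_def by (rule LeastI)
    \<comment> \<open>The position just before the leftmost common cut: every step of the scan that
      ends at or before \<open>m\<close> is deterministic.\<close>
    define m where "m = N + int k - 1"
    have m: "m + 1 \<in> C" using \<open>N + int k \<in> C\<close> by (simp add: m_def)
    have least: "p + 1 \<notin> C" if "p < m" for p
    proof
      assume C: "p + 1 \<in> C"
      then have "N + int (nat (p + 1 - N)) \<in> C" using lower by simp
      then have "k \<le> nat (p + 1 - N)" unfolding k_def by (rule Least_le)
      then show False using lower[OF C] that by (simp add: m_def)
    qed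
    obtain p where p: "p < m" "s p = s m"
      using deterministic_recurs[OF fin] s_step least by metis
    \<comment> \<open>In state \<open>s m\<close> both unread parts have length 1, so its recurrence
      at \<open>p\<close> produces a common cut further to the left.\<close>
    have "p + 1 \<in> C" using m p(2) P.length_rest_1_iff Q.length_rest_1_iff
      unfolding C_def s_def prod.inject Int_iff by metis
    then show False using least p(1) by blast
  qed
  ultimately obtain n\<^sub>0 n\<^sub>0' where n0: "c n\<^sub>0 = c' n\<^sub>0'" by (auto simp: C_def)
  have "x' (n + (n\<^sub>0' - n\<^sub>0)) = x n \<and> c' (n + (n\<^sub>0' - n\<^sub>0)) = c n" for n
  proof -
    \<comment> \<open>A common cut to the left of both \<open>c n\<close> and
      \<open>c n\<^sub>0\<close> forces the index shift at \<open>n\<close> to be the one already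
      fixed at \<open>n\<^sub>0\<close>.\<close>
    obtain m m' where m: "c m = c' m'" "c m < min (c n) (c n\<^sub>0)"
      using unbounded[of "min (c n) (c n\<^sub>0)"] unfolding C_def by (metis IntE imageE)
    then have le: "m \<le> n" "m \<le> n\<^sub>0"
      unfolding min_less_iff_conj strict_mono_less[OF P.cut_strict_mono] by simp_all
    have "c' (n\<^sub>0 + (m' - m)) = c' n\<^sub>0'"
      using common_cut_forward[OF assms(1,3,4) m(1) le(2)] n0 by simp
    then have "n\<^sub>0 + (m' - m) = n\<^sub>0'" using strict_mono_eq[OF Q.cut_strict_mono] by simp
    then have "m' - m = n\<^sub>0' - n\<^sub>0" by simp
    then show ?thesis using common_cut_forward[OF assms(1,3,4) m(1) le(1)] by simp
  qed
  then show ?thesis by blast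
qed

section \<open>From unique parsings to recognizability\<close>

text \<open>The common target of all hypotheses: it follows from elementarity, passes along
  rotational conjugacy, and is vacuous when every parsed point is periodic. The index shift
  \<open>d\<close> is present because a parsing does not fix which block is number 0.\<close>

definition unique_parsing :: "('a, 'b) morphism \<Rightarrow> bool" where
  "unique_parsing \<sigma> \<longleftrightarrow>
     (\<forall>y x c x' c'. aperiodic y \<longrightarrow> parsing \<sigma> y x c \<longrightarrow> parsing \<sigma> y x' c' \<longrightarrow>
        (\<exists>d. \<forall>n. x' (n + d) = x n \<and> c' (n + d) = c n))"

lemma elementary_unique_parsing: "elementary \<sigma> \<Longrightarrow> unique_parsing \<sigma>"
  using elementary_parsing_unique unfolding unique_parsing_def by blast

lemma representation_parsing:
  assumes "nonerasing \<sigma>" "representation \<sigma> y (k, x)"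
  shows "parsing \<sigma> y x (\<lambda>n. block_start \<sigma> x n - k)"
proof
  show "y (block_start \<sigma> x n - k + int i) = \<sigma> (x n) ! i" if "i < length (\<sigma> (x n))" for i n
    using assms morph_ext_block[OF assms(1), of i x n] that
    by (simp add: representation_def shift_pow_def algebra_simps)
qed (use assms(1) in \<open>simp_all add: block_start_Suc\<close>)

lemma unique_parsing_recognizable:
  assumes "nonerasing \<sigma>" "unique_parsing \<sigma>"
  shows "fully_recognizable_aperiodic \<sigma>"
  unfolding fully_recognizable_aperiodic_def
proof (intro allI impI Uniq_I)
  fix y p q
  assume y: "aperiodic y" and pq: "centered_representation \<sigma> y p" "centered_representation \<sigma> y q"
  obtain k x k' x' where eqs: "p = (k, x)" "q = (k', x')" by (metis prod.exhaust)
  define c where "c n = block_start \<sigma> x n - k" for n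
  define c' where "c' n = block_start \<sigma> x' n - k'" for n
  have "parsing \<sigma> y x c" "parsing \<sigma> y x' c'"
    using pq representation_parsing[OF assms(1)] eqs
    unfolding c_def c'_def centered_representation_def by auto
  then interpret P: parsing \<sigma> y x c + Q: parsing \<sigma> y x' c' .
  have range: "c 0 \<le> 0" "0 < c (0 + 1)" "c' 0 \<le> 0" "0 < c' (0 + 1)"
    using pq eqs unfolding c_def c'_def block_start_Suc block_start_0
    by (auto simp: centered_representation_def)
  obtain d where d: "\<And>n. x' (n + d) = x n" "\<And>n. c' (n + d) = c n"
    using assms(2) y P.parsing_axioms Q.parsing_axioms unfolding unique_parsing_def by metis
  \<comment> \<open>By centering, position 0 lies in block 0 of either parsing. Block
    \<open>d\<close> of the second parsing is block 0 of the first, so it covers position 0 as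
    well.\<close>
  have "c' d < c' (0 + 1)" "c' 0 < c' (d + 1)"
    using range d(2)[of 0] d(2)[of 1] by (simp_all add: add.commute)
  then have "d = 0" unfolding strict_mono_less[OF Q.cut_strict_mono] by simp
  then have "x' = x" "c' 0 = c 0" using d(1) d(2)[of 0] by auto
  then show "p = q" using eqs by (simp add: c_def c'_def block_start_0)
qed

section \<open>Rotational conjugacy\<close>

lemma periodic_shift_pow: "periodic (shift_pow k y) \<longleftrightarrow> periodic y"
proof -
  have "(\<forall>p. y (p + d + k) = y (p + k)) \<longleftrightarrow> (\<forall>p. y (p + d) = y p)" for d
  proof
    assume shifted: "\<forall>p. y (p + d + k) = y (p + k)"
    show "\<forall>p. y (p + d) = y p"
    proof
      show "y (p + d) = y p" for p using shifted[rule_format, of "p - k"] by (simp add: algebra_simps)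
    qed
  next
    assume per: "\<forall>p. y (p + d) = y p"
    show "\<forall>p. y (p + d + k) = y (p + k)"
    proof
      show "y (p + d + k) = y (p + k)" for p using per[rule_format, of "p + k"] by (simp add: algebra_simps)
    qed
  qed
  then show ?thesis by (simp add: periodic_iff shift_pow_def)
qed

text \<open>Every cut is followed by an occurrence of \<open>w\<close>, so moving all cuts to the
  right by its length turns each block of \<open>\<sigma>\<close> into the block of
  \<open>\<tau>\<close>.\<close>

lemma parsing_conjugate_right:
  assumes "parsing \<sigma> y x c" "nonerasing \<tau>" and conj: "\<And>a. \<sigma> a @ w = w @ \<tau> a"
  shows "parsing \<tau> (shift_pow (int (length w)) y) x c"
proof -
  interpret P: parsing \<sigma> y x c by fact
  have len: "length (\<tau> a) = length (\<sigma> a)" for a using arg_cong[OF conj[of a], of length] by simp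
  have nth: "(\<sigma> a @ w) ! i = (w @ \<tau> a) ! i" for a i using conj by simp
  \<comment> \<open>A letter of \<open>w\<close> that reaches beyond the current block is an earlier
    letter of \<open>w\<close> read from the next cut; hence the induction on
    \<open>i\<close>.\<close>
  have w: "y (c n + int i) = w ! i" if "i < length w" for i n
    using that
  proof (induction i arbitrary: n rule: less_induct)
    case (less i)
    show ?case
    proof (cases "i < length (\<sigma> (x n))")
      case True
      then show ?thesis using P.cut_block[OF True] nth[of "x n" i] less.prems by (simp add: nth_append)
    next
      case False
      define j where "j = i - length (\<sigma> (x n))"
      have i: "i = length (\<sigma> (x n)) + j" using False by (simp add: j_def)
      have "j < i" using i P.nonerasing by (simp add: nonerasing_def)
      then have "y (c (n + 1) + int j) = w ! j" using less by simp
      then show ?thesis using nth[of "x n" i] less.prems i by (simp add: nth_append P.cut_step add.assoc)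
    qed
  qed
  show ?thesis
  proof
    show "shift_pow (int (length w)) y (c n + int i) = \<tau> (x n) ! i" if i: "i < length (\<tau> (x n))" for n i
    proof (cases "length w + i < length (\<sigma> (x n))")
      case True
      then show ?thesis using P.cut_block[OF True] nth[of "x n" "length w + i"]
        by (simp add: shift_pow_def nth_append algebra_simps)
    next
      case False
      define j where "j = length w + i - length (\<sigma> (x n))"
      have j: "length w + i = length (\<sigma> (x n)) + j" using False by (simp add: j_def)
      then have "j < length w" using i len[of "x n"] by linarith
      then have "y (c (n + 1) + int j) = w ! j" by (rule w)
      moreover have "c n + int i + int (length w) = c (n + 1) + int j"
        unfolding P.cut_step using j by linarith
      moreover have "\<tau> (x n) ! i = w ! j" using nth[of "x n" "length w + i"] False by (simp add: nth_append j_def)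
      ultimately show ?thesis by (simp add: shift_pow_def)
    qed
  qed (use assms(2) len P.cut_step in simp_all)
qed

text \<open>The mirror image: an occurrence of \<open>w\<close> ends at every cut.\<close>

lemma parsing_conjugate_left:
  assumes "parsing \<sigma> y x c" "nonerasing \<tau>" and conj: "\<And>a. w @ \<sigma> a = \<tau> a @ w"
  shows "parsing \<tau> (shift_pow (- int (length w)) y) x c"
proof -
  interpret P: parsing \<sigma> y x c by fact
  have len: "length (\<tau> a) = length (\<sigma> a)" for a using arg_cong[OF conj[of a], of length] by simp
  have nth: "(\<tau> a @ w) ! i = (w @ \<sigma> a) ! i" for a i using conj by simp
  \<comment> \<open>Seen from the previous cut \<open>m\<close>, letter \<open>i\<close> is letter
    \<open>j\<close> of \<open>w @ \<sigma> (x m)\<close>: either in the block or a later letter of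
    \<open>w\<close>, so the induction is on the distance to the end of \<open>w\<close>.\<close>
  have w: "y (c n - int (length w) + int i) = w ! i" if "i < length w" for i n
    using that
  proof (induction "length w - i" arbitrary: i n rule: less_induct)
    case less
    define m where "m = n - 1"
    define j where "j = length (\<sigma> (x m)) + i"
    have pos: "c n - int (length w) + int i = c m - int (length w) + int j"
      using P.cut_step[of m] by (simp add: m_def j_def)
    have j: "w ! i = (w @ \<sigma> (x m)) ! j"
      using nth[of "x m" j] len[of "x m"] by (simp add: nth_append j_def)
    show ?case
    proof (cases "j < length w")
      case True
      moreover have "i < j" using P.nonerasing by (simp add: j_def nonerasing_def)
      ultimately have "y (c m - int (length w) + int j) = w ! j" using less by simp
      then show ?thesis unfolding pos using j True by (simp add: nth_append)
    next
      case False
      define l where "l = j - length w"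
      have l: "l < length (\<sigma> (x m))" "int j = int (length w) + int l"
        using less.prems False by (auto simp: l_def j_def)
      then show ?thesis unfolding pos using P.cut_block[OF l(1)] j False by (simp add: nth_append l_def algebra_simps)
    qed
  qed
  show ?thesis
  proof
    show "shift_pow (- int (length w)) y (c n + int i) = \<tau> (x n) ! i" if i: "i < length (\<tau> (x n))" for n i
    proof (cases "i < length w")
      case True
      then show ?thesis using w[OF True, of n] nth[of "x n" i] i
        by (simp add: shift_pow_def nth_append algebra_simps)
    next
      case False
      define l where "l = i - length w"
      have l: "l < length (\<sigma> (x n))" "int i = int (length w) + int l"
        using i len[of "x n"] False by (auto simp: l_def)
      then show ?thesis using P.cut_block[OF l(1)] nth[of "x n" i] i False
        by (simp add: shift_pow_def nth_append l_def algebra_simps)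
    qed
  qed (use assms(2) len P.cut_step in simp_all)
qed

lemma unique_parsing_conjugate:
  assumes "nonerasing \<tau>" "rotationally_conjugate \<sigma> \<tau>" "unique_parsing \<tau>"
  shows "unique_parsing \<sigma>"
proof -
  obtain k where k: "\<And>y x c. parsing \<sigma> y x c \<Longrightarrow> parsing \<tau> (shift_pow k y) x c"
    using assms(1,2) parsing_conjugate_right parsing_conjugate_left
    unfolding rotationally_conjugate_def by metis
  show ?thesis
    unfolding unique_parsing_def
  proof (intro allI impI)
    fix y x c x' c'
    assume "aperiodic y" "parsing \<sigma> y x c" "parsing \<sigma> y x' c'"
    then have "aperiodic (shift_pow k y)" "parsing \<tau> (shift_pow k y) x c" "parsing \<tau> (shift_pow k y) x' c'"
      using k by (simp_all add: periodic_shift_pow)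
    then show "\<exists>d. \<forall>n. x' (n + d) = x n \<and> c' (n + d) = c n"
      using assms(3) unfolding unique_parsing_def by blast
  qed
qed

section \<open>Sufficient conditions for elementarity\<close>

text \<open>For \<open>h\<close> the first or the last letter, each image inherits its value from
  one of its factors in \<open>P\<close>, so distinct values need as many words in
  \<open>P\<close>.\<close>

lemma elementaryI_inj:
  fixes \<sigma> :: "('a::finite, 'b) morphism" and h :: "'b list \<Rightarrow> 'c"
  assumes "inj (h \<circ> \<sigma>)"
    and "\<And>P a. [] \<notin> P \<Longrightarrow> \<sigma> a \<in> concat ` lists P \<Longrightarrow> h (\<sigma> a) \<in> h ` P"
  shows "elementary \<sigma>"
  unfolding elementary_def
proof (intro allI impI)
  fix P assume P: "finite P" "[] \<notin> P" "range \<sigma> \<subseteq> concat ` lists P"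
  have "\<sigma> a \<in> concat ` lists P" for a using P(3) by blast
  then have "range (h \<circ> \<sigma>) \<subseteq> h ` P" using assms(2)[OF P(2)] by (simp add: image_subset_iff)
  then have "card (range (h \<circ> \<sigma>)) \<le> card (h ` P)" using P(1) by (intro card_mono) auto
  also have "\<dots> \<le> card P" using P(1) by (rule card_image_le)
  finally show "CARD('a) \<le> card P" using card_image[OF assms(1)] by simp
qed

lemma left_permutative_elementary:
  assumes "nonerasing \<sigma>" "left_permutative \<sigma>"
  shows "elementary \<sigma>"
proof (rule elementaryI_inj)
  show "inj (hd \<circ> \<sigma>)" using assms(2) by (auto simp: left_permutative_def inj_def)
  fix P a assume "[] \<notin> P" "\<sigma> a \<in> concat ` lists P"
  then obtain ws where ws: "\<sigma> a = concat ws" "set ws \<subseteq> P" by auto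
  have "ws \<noteq> []" using ws(1) assms(1) by (auto simp: nonerasing_def)
  then obtain v vs where "ws = v # vs" by (cases ws) auto
  then have "v \<in> P" "v \<noteq> []" using ws \<open>[] \<notin> P\<close> by auto
  then show "hd (\<sigma> a) \<in> hd ` P" using ws(1) \<open>ws = v # vs\<close> by simp
qed

lemma right_permutative_elementary:
  assumes "nonerasing \<sigma>" "right_permutative \<sigma>"
  shows "elementary \<sigma>"
proof (rule elementaryI_inj)
  show "inj (last \<circ> \<sigma>)" using assms(2) by (auto simp: right_permutative_def inj_def)
  fix P a assume "[] \<notin> P" "\<sigma> a \<in> concat ` lists P"
  then obtain ws where ws: "\<sigma> a = concat ws" "set ws \<subseteq> P" by auto
  have "ws \<noteq> []" using ws(1) assms(1) by (auto simp: nonerasing_def)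
  then obtain v vs where vs: "ws = vs @ [v]" by (cases ws rule: rev_cases) auto
  then have "v \<in> P" "v \<noteq> []" using ws \<open>[] \<notin> P\<close> by auto
  then show "last (\<sigma> a) \<in> last ` P" using ws(1) vs by simp
qed

text \<open>Abelianization: the columns lie in the span of the letter-count vectors of the words in
  \<open>P\<close>, so \<open>card P\<close> bounds the rank.\<close>

lemma full_rank_elementary:
  fixes \<sigma> :: "('a::finite, 'b::finite) morphism"
  assumes "rank (incidence_matrix \<sigma>) = CARD('a)"
  shows "elementary \<sigma>"
  unfolding elementary_def
proof (intro allI impI)
  fix P assume P: "finite P" "[] \<notin> P" "range \<sigma> \<subseteq> concat ` lists P"
  define ab :: "'b list \<Rightarrow> real ^ 'b" where "ab w = (\<chi> i. real (count_list w i))" for w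
  have ab_append: "ab (u @ v) = ab u + ab v" for u v by (simp add: ab_def vec_eq_iff)
  have span: "ab (concat ws) \<in> span (ab ` P)" if "set ws \<subseteq> P" for ws
    using that
  proof (induction ws)
    case Nil
    have "ab [] = 0" by (simp add: ab_def vec_eq_iff)
    then show ?case by (simp add: span_zero)
  qed (auto simp: ab_append intro: span_add span_base)
  have "column a (incidence_matrix \<sigma>) \<in> span (ab ` P)" for a
  proof -
    have "\<sigma> a \<in> concat ` lists P" using P(3) by blast
    then obtain ws where "set ws \<subseteq> P" "\<sigma> a = concat ws" by auto
    moreover have "column a (incidence_matrix \<sigma>) = ab (\<sigma> a)"
      by (simp add: column_def incidence_matrix_def ab_def)
    ultimately show ?thesis using span by simp
  qed
  then have "columns (incidence_matrix \<sigma>) \<subseteq> span (ab ` P)" by (auto simp: columns_def)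
  then have "dim (columns (incidence_matrix \<sigma>)) \<le> card (ab ` P)" using P(1) by (intro dim_le_card) auto
  also have "\<dots> \<le> card P" using P(1) by (rule card_image_le)
  finally show "CARD('a) \<le> card P" using assms by (simp add: column_rank_def)
qed

section \<open>Morphisms on two letters\<close>

lemma nth_concat_single:
  assumes "v \<in> concat ` lists {p}"
  shows "length p dvd length v" and "i < length v \<Longrightarrow> v ! i = p ! (i mod length p)"
proof -
  have "length p dvd length v \<and> (\<forall>i < length v. v ! i = p ! (i mod length p))"
  proof -
    obtain ws where "v = concat ws" "set ws \<subseteq> {p}" using assms by auto
    then show ?thesis
    proof (induction ws arbitrary: v)
      case (Cons u ws)
      then have IH: "length p dvd length (concat ws)"
        "\<And>i. i < length (concat ws) \<Longrightarrow> concat ws ! i = p ! (i mod length p)"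
        by auto
      have v: "v = p @ concat ws" using Cons.prems by simp
      show ?case unfolding v using IH by (auto simp: nth_append le_mod_geq)
    qed simp
  qed
  then show "length p dvd length v" "i < length v \<Longrightarrow> v ! i = p ! (i mod length p)" by auto
qed

text \<open>All block lengths are multiples of the length of \<open>p\<close>, so all cuts are
  congruent to \<open>c 0\<close> and \<open>y\<close> reads \<open>p\<close> cyclically from
  there.\<close>

lemma single_word_periodic:
  assumes "parsing \<sigma> y x c" "range \<sigma> \<subseteq> concat ` lists {p}" "p \<noteq> []"
  shows "periodic y"
proof -
  interpret P: parsing \<sigma> y x c by fact
  have \<sigma>: "\<sigma> a \<in> concat ` lists {p}" for a using assms(2) by auto
  have y: "y q = p ! nat ((q - c 0) mod int (length p))" for q
  proof -
    obtain n where n: "c n \<le> q" "q < c (n + 1)" using P.block_ex by blast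
    define k where "k = nat (q - c n)"
    have k: "k < length (\<sigma> (x n))" "q = c n + int k" using n P.cut_step[of n] by (auto simp: k_def)
    have "int (length p) dvd block_start \<sigma> x n"
      unfolding block_start_def using nth_concat_single(1)[OF \<sigma>]
      by (intro dvd_diff dvd_sum) simp_all
    then have "(q - c 0) mod int (length p) = int k mod int (length p)"
      using k(2) P.cut_eq_block_start[of n] by (auto elim!: dvdE)
    then show ?thesis
      using P.cut_block[OF k(1)] k nth_concat_single(2)[OF \<sigma> k(1)] by (simp add: zmod_int[symmetric])
  qed
  have "y (q + int (length p)) = y q" for q
  proof -
    have "(q + int (length p) - c 0) mod int (length p) = (q - c 0 + int (length p)) mod int (length p)"
      by (simp add: algebra_simps)
    then show ?thesis unfolding y[of q] y[of "q + int (length p)"] by simp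
  qed
  then show ?thesis using assms(3) unfolding periodic_iff by (intro exI[of _ "int (length p)"]) simp
qed

lemma two_letters_unique_parsing:
  fixes \<sigma> :: "('a::finite, 'b) morphism"
  assumes "CARD('a) = 2" "nonerasing \<sigma>"
  shows "unique_parsing \<sigma>"
proof (cases "elementary \<sigma>")
  case True
  then show ?thesis by (rule elementary_unique_parsing)
next
  case False
  \<comment> \<open>Fewer than two generators leave a single word \<open>p\<close>, so no aperiodic
    point has a parsing.\<close>
  then obtain P where P: "finite P" "[] \<notin> P" "range \<sigma> \<subseteq> concat ` lists P" "card P < 2"
    using assms(1) by (auto simp: elementary_def not_le)
  have "\<sigma> undefined \<in> concat ` lists P" using P(3) by blast
  then have "P \<noteq> {}" using assms(2) by (auto simp: nonerasing_def)
  then have "card P = 1" using P(1,4) card_gt_0_iff[of P] by linarith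
  then obtain p where "P = {p}" by (rule card_1_singletonE)
  then show ?thesis using single_word_periodic[of \<sigma> _ _ _ p] P(2,3) by (auto simp: unique_parsing_def)
qed

theorem theorem3p1:
  fixes \<sigma> :: "('a::finite, 'b::finite) morphism"
  assumes "nonerasing \<sigma>"
    and "rank (incidence_matrix \<sigma>) = CARD('a)
      \<or> CARD('a) = 2
      \<or> (left_permutative \<sigma> \<or> right_permutative \<sigma>
          \<or> (\<exists>\<tau>. nonerasing \<tau> \<and> rotationally_conjugate \<sigma> \<tau>
                \<and> (left_permutative \<tau> \<or> right_permutative \<tau>)))"
  shows "fully_recognizable_aperiodic \<sigma>"
proof -
  have permutative: "unique_parsing \<tau>"
    if "nonerasing \<tau>" "left_permutative \<tau> \<or> right_permutative \<tau>" for \<tau> :: "('a, 'b) morphism"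
    using that left_permutative_elementary right_permutative_elementary elementary_unique_parsing by blast
  have "unique_parsing \<sigma>"
    using assms permutative full_rank_elementary[of \<sigma>] elementary_unique_parsing[of \<sigma>]
      two_letters_unique_parsing[of \<sigma>] unique_parsing_conjugate[of _ \<sigma>] by blast
  with assms(1) show ?thesis by (rule unique_parsing_recognizable)
qed

end
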